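(* Let $\mathbf{Z}=\begin{pmatrix}\mathbf{X}\\ \mathbf{Y}\end{pmatrix}=[\mathbf{z}_1\,|\,\mathbf{z}_2]\in\mathbb{R}^{4\times2}$ be a Lagrangian frame, let $\mathbf{U}=\mathbf{z}_1\wedge\mathbf{z}_2=\sum_{j=1}^6U_j\mathbf{E}_j\in\bigwedge^2(\mathbb{R}^4)$, and let $\mathbf{Q}=(\mathbf{X}-\mathrm{i}\mathbf{Y})(\mathbf{X}+\mathrm{i}\mathbf{Y})^{-1}$. Then $$\mathrm{Trace}(\mathbf{Q})=\frac{2}{\overline{K(\mathbf{U})}}\,(U_1+U_6).$$
   Context: $\mathbf{J}=\begin{pmatrix}\mathbf{0}&-\mathbf{I}\\ \mathbf{I}&\mathbf{0}\end{pmatrix}$ is the standard symplectic operator on $\mathbb{R}^4$ ($2\times2$ blocks). A Lagrangian frame is a real $4\times2$ matrix $\mathbf{Z}$ of rank 2, with columns $\mathbf{z}_1,\mathbf{z}_2$ satisfying $\langle\mathbf{J}\mathbf{z}_1,\mathbf{z}_2\rangle=0$; it is partitioned into $2\times2$ real blocks $\mathbf{X}$ (top) and $\mathbf{Y}$ (bottom). With $\mathbf{e}_1,\dots,\mathbf{e}_4$ the canonical basis of $\mathbb{R}^4$, the basis of $\bigwedge^2(\mathbb{R}^4)$ is $\mathbf{E}_1=\mathbf{e}_1\wedge\mathbf{e}_2$, $\mathbf{E}_2=\mathbf{e}_1\wedge\mathbf{e}_3$, $\mathbf{E}_3=\mathbf{e}_1\wedge\mathbf{e}_4$, $\mathbf{E}_4=\mathbf{e}_2\wedge\mathbf{e}_3$,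 $\mathbf{E}_5=\mathbf{e}_2\wedge\mathbf{e}_4$, $\mathbf{E}_6=\mathbf{e}_3\wedge\mathbf{e}_4$. The function $K$ is $K(\mathbf{U})=U_1-\mathrm{i}U_3+\mathrm{i}U_4-U_6$ (which equals $\det[\mathbf{X}-\mathrm{i}\mathbf{Y}]$ for a Lagrangian frame). *)

theory Defs
  imports "HOL-Analysis.Analysis"
begin

lemma transpose_arith [simp]:
  fixes A B :: "'a::real_vector^'n^'m"
  shows "transpose 0 = (0 :: 'a^'n^'m)" "transpose (A + B) = transpose A + transpose B"
    "transpose (- A) = - transpose A" "transpose (A - B) = transpose A - transpose B"
    "transpose (c *\<^sub>R A) = c *\<^sub>R transpose A"
  by (simp_all add: transpose_def vec_eq_iff)

text \<open>The exterior square of \<open>\<real>\<^sup>4\<close>, modelled as the space of skew-symmetric tensors in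
  \<open>\<real>\<^sup>4 \<otimes> \<real>\<^sup>4\<close>, with \<open>x \<and> y = x \<otimes> y - y \<otimes> x\<close>. The normalization of the wedge product is
  irrelevant below, since coordinates are always taken with respect to the \<open>e\<^sub>i \<and> e\<^sub>j\<close>.\<close>

typedef ext2 = "{A :: real^4^4. transpose A = - A}"
  morphisms tensor_of Abs_ext2
  by (rule exI[of _ 0]) (simp add: transpose_def vec_eq_iff)

setup_lifting type_definition_ext2

instantiation ext2 :: real_vector
begin

lift_definition zero_ext2 :: ext2 is 0
  by simp

lift_definition plus_ext2 :: "ext2 \<Rightarrow> ext2 \<Rightarrow> ext2" is "(+)"
  by simp

lift_definition uminus_ext2 :: "ext2 \<Rightarrow> ext2" is uminus
  by simp

lift_definition minus_ext2 :: "ext2 \<Rightarrow> ext2 \<Rightarrow> ext2" is "(-)"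
  by simp

lift_definition scaleR_ext2 :: "real \<Rightarrow> ext2 \<Rightarrow> ext2" is "(*\<^sub>R)"
  by simp

instance
  by standard (transfer; simp add: algebra_simps)+

end

lift_definition wedge :: "real^4 \<Rightarrow> real^4 \<Rightarrow> ext2"  (infixl \<open>\<and>\<^sub>E\<close> 70)
  is "\<lambda>x y. \<chi> i j. x $ i * y $ j - y $ i * x $ j"
  by (simp add: transpose_def vec_eq_iff)

abbreviation e :: "4 \<Rightarrow> real^4"
  where "e k \<equiv> axis k 1"

definition E :: "nat \<Rightarrow> ext2" where
  "E j = [e 1 \<and>\<^sub>E e 2, e 1 \<and>\<^sub>E e 3, e 1 \<and>\<^sub>E e 4, e 2 \<and>\<^sub>E e 3, e 2 \<and>\<^sub>E e 4, e 3 \<and>\<^sub>E e 4] ! (j - 1)"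

definition ext2_coord :: "ext2 \<Rightarrow> nat \<Rightarrow> real" where
  "ext2_coord U j = representation (E ` {1..6}) U (E j)"

definition K :: "ext2 \<Rightarrow> complex" where
  "K U = ext2_coord U 1 - \<i> * ext2_coord U 3 + \<i> * ext2_coord U 4 - ext2_coord U 6"

definition J :: "real^4^4" where
  "J = vector [vector [0, 0, -1,  0],
               vector [0, 0,  0, -1],
               vector [1, 0,  0,  0],
               vector [0, 1,  0,  0]]"

definition lagrangian_frame :: "real^2^4 \<Rightarrow> bool" where
  "lagrangian_frame Z \<longleftrightarrow> rank Z = 2 \<and> (J *v column 1 Z) \<bullet> column 2 Z = 0"

text \<open>The blocks are given by their rows, \<open>Z $ i\<close> being the \<open>i\<close>-th row of \<open>Z\<close>.\<close>

definition top_block :: "real^2^4 \<Rightarrow> real^2^2" where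
  "top_block Z = vector [Z $ 1, Z $ 2]"

definition bottom_block :: "real^2^4 \<Rightarrow> real^2^2" where
  "bottom_block Z = vector [Z $ 3, Z $ 4]"


text \<open>\<open>E 1, \<dots>, E 6\<close> is a basis, so \<open>ext2_coord\<close> gives the coordinates with respect to it.\<close>

lemma E_simps [simp]:
  "E (Suc 0) = e 1 \<and>\<^sub>E e 2" "E 1 = e 1 \<and>\<^sub>E e 2" "E 2 = e 1 \<and>\<^sub>E e 3" "E 3 = e 1 \<and>\<^sub>E e 4"
  "E 4 = e 2 \<and>\<^sub>E e 3" "E 5 = e 2 \<and>\<^sub>E e 4" "E 6 = e 3 \<and>\<^sub>E e 4"
  by (simp_all add: E_def eval_nat_numeral)

lemma sum_1_6: "(\<Sum>j=1..6. f j) = f 1 + f 2 + f 3 + f 4 + f 5 + f 6"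
  for f :: "nat \<Rightarrow> 'a::comm_monoid_add"
  by (simp add: eval_nat_numeral add.assoc)

lemma tensor_of_sum_E:
  "tensor_of (\<Sum>j=1..6. c j *\<^sub>R E j) $ 1 $ 2 = c 1"
  "tensor_of (\<Sum>j=1..6. c j *\<^sub>R E j) $ 1 $ 3 = c 2"
  "tensor_of (\<Sum>j=1..6. c j *\<^sub>R E j) $ 1 $ 4 = c 3"
  "tensor_of (\<Sum>j=1..6. c j *\<^sub>R E j) $ 2 $ 3 = c 4"
  "tensor_of (\<Sum>j=1..6. c j *\<^sub>R E j) $ 2 $ 4 = c 5"
  "tensor_of (\<Sum>j=1..6. c j *\<^sub>R E j) $ 3 $ 4 = c 6"
  unfolding sum_1_6
  by (simp_all add: plus_ext2.rep_eq scaleR_ext2.rep_eq wedge.rep_eq axis_def)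

lemma ext2_eqI:
  assumes "tensor_of U $ 1 $ 2 = tensor_of V $ 1 $ 2" "tensor_of U $ 1 $ 3 = tensor_of V $ 1 $ 3"
    "tensor_of U $ 1 $ 4 = tensor_of V $ 1 $ 4" "tensor_of U $ 2 $ 3 = tensor_of V $ 2 $ 3"
    "tensor_of U $ 2 $ 4 = tensor_of V $ 2 $ 4" "tensor_of U $ 3 $ 4 = tensor_of V $ 3 $ 4"
  shows "U = V"
proof -
  have skew: "tensor_of W $ i $ j = - tensor_of W $ j $ i" for W i j
  proof -
    have "transpose (tensor_of W) = - tensor_of W"
      using tensor_of[of W] by simp
    from arg_cong[OF this, of "\<lambda>A. A $ j $ i"] show ?thesis
      by (simp add: transpose_def)
  qed
  have diag: "tensor_of W $ i $ i = 0" for W i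
    using skew[of W i i] by simp
  have "\<forall>i j. tensor_of U $ i $ j = tensor_of V $ i $ j"
    unfolding forall_4 diag skew[of _ 2 1] skew[of _ 3 1] skew[of _ 4 1] skew[of _ 3 2]
      skew[of _ 4 2] skew[of _ 4 3]
    using assms by simp
  then show ?thesis
    by (simp add: vec_eq_iff flip: tensor_of_inject)
qed

lemma E_coeffs_unique:
  assumes "(\<Sum>j=1..6. c j *\<^sub>R E j) = (\<Sum>j=1..6. d j *\<^sub>R E j)" "j \<in> {1..6}"
  shows "c j = d j"
proof -
  have "j = 1 \<or> j = 2 \<or> j = 3 \<or> j = 4 \<or> j = 5 \<or> j = 6"
    using assms(2) by auto
  then show ?thesis
    using tensor_of_sum_E[of c, unfolded assms(1), unfolded tensor_of_sum_E]
    by (elim disjE) simp_all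
qed

lemma inj_on_E: "inj_on E {1..6}"
proof (rule inj_onI)
  fix i j :: nat assume ij: "i \<in> {1..6}" "j \<in> {1..6}" "E i = E j"
  have delta: "(\<Sum>k=1..6. (if k = l then 1 else 0) *\<^sub>R E k) = E l" if "l \<in> {1..6}" for l
  proof -
    have "(\<Sum>k=1..6. (if k = l then 1 else 0) *\<^sub>R E k) = (\<Sum>k=1..6. if k = l then E k else 0)"
      by (rule sum.cong) auto
    then show ?thesis using that by (simp add: sum.delta')
  qed
  have "(\<Sum>k=1..6. (if k = i then 1 else 0) *\<^sub>R E k) = (\<Sum>k=1..6. (if k = j then 1 else 0) *\<^sub>R E k)"
    using delta[OF ij(1)] delta[OF ij(2)] ij(3) by simp
  from E_coeffs_unique[OF this ij(1)] show "i = j"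
    by (simp split: if_splits)
qed

lemma independent_E: "independent (E ` {1..6})"
proof (rule independent_if_scalars_zero)
  fix f x assume f: "(\<Sum>x\<in>E ` {1..6}. f x *\<^sub>R x) = 0" and x: "x \<in> E ` {1..6}"
  have "(\<Sum>j=1..6. f (E j) *\<^sub>R E j) = (\<Sum>j=1..6. 0 *\<^sub>R E j)"
    using f by (simp add: sum.reindex[OF inj_on_E] del: One_nat_def)
  then have "f (E j) = 0" if "j \<in> {1..6}" for j
    using E_coeffs_unique[of "\<lambda>j. f (E j)" "\<lambda>_. 0"] that by blast
  with x show "f x = 0" by blast
qed simp

lemma span_E: "span (E ` {1..6}) = UNIV"
proof -
  have "U \<in> span (E ` {1..6})" for U
  proof -
    define c where "c j = [tensor_of U $ 1 $ 2, tensor_of U $ 1 $ 3, tensor_of U $ 1 $ 4,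
      tensor_of U $ 2 $ 3, tensor_of U $ 2 $ 4, tensor_of U $ 3 $ 4] ! (j - 1)" for j :: nat
    have "U = (\<Sum>j=1..6. c j *\<^sub>R E j)"
      by (rule ext2_eqI; unfold tensor_of_sum_E) (simp_all add: c_def eval_nat_numeral)
    also have "\<dots> \<in> span (E ` {1..6})"
      by (intro span_sum span_scale span_base imageI)
    finally show ?thesis .
  qed
  then show ?thesis by blast
qed

lemma ext2_expansion: "U = (\<Sum>j=1..6. ext2_coord U j *\<^sub>R E j)"
proof -
  have "(\<Sum>x\<in>E ` {1..6}. representation (E ` {1..6}) U x *\<^sub>R x) = U"
    using sum_representation_eq[OF independent_E, of U "E ` {1..6}"] span_E by simp
  then show ?thesis
    by (simp add: sum.reindex[OF inj_on_E] ext2_coord_def del: One_nat_def)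
qed

lemma ext2_coord_unique:
  assumes "U = (\<Sum>j=1..6. c j *\<^sub>R E j)" "j \<in> {1..6}"
  shows "ext2_coord U j = c j"
  using E_coeffs_unique[of "ext2_coord U" c j] ext2_expansion[of U] assms by simp

end

theory Submission
  imports Defs
begin

text \<open>
  Write \<open>B = X + \<i>Y\<close>, so that \<open>X - \<i>Y\<close> is the entrywise conjugate of
  \<open>B\<close> and \<open>Q = cnj B ** B\<inverse>\<close>. Since the inverse of a \<open>2 \<times>
  2\<close> matrix is its adjugate divided by its determinant, the trace of \<open>Q\<close> is the polarized
  determinant \<open>det (cnj B + B) - det (cnj B) - det B\<close> divided by \<open>det B\<close>
  (\<open>trace_times_matrix_inv_2\<close>). Expanding in the minors of \<open>Z\<close>, which are the
  coordinates of \<open>U\<close>, turns the numerator into \<open>2 (U\<^sub>1 + U\<^sub>6)\<close> and the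
  denominator into \<open>cnj (K U)\<close> (\<open>det_blocks\<close>).

  The Lagrangian condition makes \<open>B\<close> invertible. It says that \<open>U\<^sub>2 + U\<^sub>5 =
  0\<close>, while \<open>det B = 0\<close> says that \<open>U\<^sub>1 = U\<^sub>6\<close> and
  \<open>U\<^sub>3 = U\<^sub>4\<close>. Under these three equations the Pluecker relation \<open>U\<^sub>1
  U\<^sub>6 - U\<^sub>2 U\<^sub>5 + U\<^sub>3 U\<^sub>4 = 0\<close> becomes \<open>U\<^sub>1\<^sup>2 +
  U\<^sub>2\<^sup>2 + U\<^sub>3\<^sup>2 = 0\<close>, so \<open>U = 0\<close>, which contradicts \<open>rank Z
  = 2\<close> (\<open>K_lagrangian_nonzero\<close>).
\<close>

lemma ext2_coord_tensor:
  "ext2_coord U 1 = tensor_of U $ 1 $ 2" "ext2_coord U 2 = tensor_of U $ 1 $ 3"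
  "ext2_coord U 3 = tensor_of U $ 1 $ 4" "ext2_coord U 4 = tensor_of U $ 2 $ 3"
  "ext2_coord U 5 = tensor_of U $ 2 $ 4" "ext2_coord U 6 = tensor_of U $ 3 $ 4"
  using tensor_of_sum_E[of "ext2_coord U", folded ext2_expansion] by simp_all

lemma wedge_coord:
  "ext2_coord (x \<and>\<^sub>E y) 1 = x $ 1 * y $ 2 - y $ 1 * x $ 2"
  "ext2_coord (x \<and>\<^sub>E y) 2 = x $ 1 * y $ 3 - y $ 1 * x $ 3"
  "ext2_coord (x \<and>\<^sub>E y) 3 = x $ 1 * y $ 4 - y $ 1 * x $ 4"
  "ext2_coord (x \<and>\<^sub>E y) 4 = x $ 2 * y $ 3 - y $ 2 * x $ 3"
  "ext2_coord (x \<and>\<^sub>E y) 5 = x $ 2 * y $ 4 - y $ 2 * x $ 4"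
  "ext2_coord (x \<and>\<^sub>E y) 6 = x $ 3 * y $ 4 - y $ 3 * x $ 4"
  by (simp_all add: ext2_coord_tensor wedge.rep_eq del: One_nat_def)

lemma wedge_pluecker:
  fixes x y :: "real^4"
  defines "U \<equiv> x \<and>\<^sub>E y"
  shows "ext2_coord U 1 * ext2_coord U 6 - ext2_coord U 2 * ext2_coord U 5
    + ext2_coord U 3 * ext2_coord U 4 = 0"
  unfolding U_def wedge_coord by (simp add: algebra_simps)

lemma lagrangian_coord_2_5:
  assumes "lagrangian_frame Z"
  shows "ext2_coord (column 1 Z \<and>\<^sub>E column 2 Z) 2 + ext2_coord (column 1 Z \<and>\<^sub>E column 2 Z) 5 = 0"
  using assms unfolding lagrangian_frame_def wedge_coord J_def
  by (simp add: inner_vec_def matrix_vector_mult_def sum_4 vector_def algebra_simps)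

lemma wedge_columns_nonzero:
  fixes Z :: "real^2^4"
  assumes "rank Z = 2"
  shows "column 1 Z \<and>\<^sub>E column 2 Z \<noteq> 0"
proof
  assume "column 1 Z \<and>\<^sub>E column 2 Z = 0"
  from arg_cong[OF this, of tensor_of]
  have minor: "Z $ i $ 1 * Z $ k $ 2 - Z $ i $ 2 * Z $ k $ 1 = 0" for i k
    by (simp add: wedge.rep_eq zero_ext2.rep_eq vec_eq_iff column_def)
  have inj: "inj ((*v) Z)"
    using assms full_rank_injective[of Z] by simp
  have ker: "v = 0" if "Z *v v = 0" for v
    using injD[OF inj, of v 0] that by simp
  have rows: "Z $ i = 0" for i
  proof -
    \<comment> \<open>The vanishing minors say that each row, rotated by a right angle, lies in the kernel.\<close>
    have "Z *v vector [Z $ i $ 2, - (Z $ i $ 1)] = 0"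
      using minor[of _ i] by (simp add: vec_eq_iff matrix_vector_mult_def sum_2 vector_2 algebra_simps)
    from ker[OF this] show ?thesis
      by (simp add: vec_eq_iff forall_2 vector_2)
  qed
  then have "Z = 0"
    by (simp add: vec_eq_iff)
  then have "(axis 1 1 :: real^2) = 0"
    by (intro ker) simp
  then show False
    by (simp add: axis_eq_0_iff)
qed

text \<open>If \<open>K\<close> vanished, the Lagrangian condition and the real and imaginary parts of \<open>K\<close> would
  identify the six coordinates in pairs up to sign, with signs that make the Pluecker quadric
  definite.\<close>

lemma K_lagrangian_nonzero:
  assumes "lagrangian_frame Z"
  shows "K (column 1 Z \<and>\<^sub>E column 2 Z) \<noteq> 0"
proof
  define U where "U = column 1 Z \<and>\<^sub>E column 2 Z"
  assume "K (column 1 Z \<and>\<^sub>E column 2 Z) = 0"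
  then have eqs: "ext2_coord U 6 = ext2_coord U 1" "ext2_coord U 4 = ext2_coord U 3"
    by (simp_all add: K_def U_def complex_eq_iff)
  have eq5: "ext2_coord U 5 = - ext2_coord U 2"
    using lagrangian_coord_2_5[OF assms] by (simp add: U_def)
  have "(ext2_coord U 1)\<^sup>2 + (ext2_coord U 2)\<^sup>2 + (ext2_coord U 3)\<^sup>2 = 0"
    using wedge_pluecker[of "column 1 Z" "column 2 Z"]
    unfolding U_def[symmetric] eqs eq5 by (simp add: power2_eq_square)
  then have "ext2_coord U 1 = 0" "ext2_coord U 2 = 0" "ext2_coord U 3 = 0"
    by (smt (verit) zero_le_power2 power_eq_0_iff)+
  with eqs eq5 have "U = 0"
    by (subst ext2_expansion) (simp only: sum_1_6, simp)
  with wedge_columns_nonzero[of Z] assms show False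
    by (simp add: U_def lagrangian_frame_def)
qed

lemma matrix_inv_eqI:
  fixes B :: "'a::semiring_1^'n^'m"
  assumes "B ** C = mat 1" "C ** B = mat 1"
  shows "matrix_inv B = C"
proof -
  have inv: "matrix_inv B ** B = mat 1"
    unfolding matrix_inv_def by (rule someI2[where a = C]) (use assms in auto)
  have "matrix_inv B = matrix_inv B ** (B ** C)"
    by (simp add: assms(1))
  also have "\<dots> = C"
    by (simp add: matrix_mul_assoc inv)
  finally show ?thesis .
qed

lemma matrix_inv_2:
  fixes B :: "'a::field^2^2"
  assumes "det B \<noteq> 0"
  shows "matrix_inv B = vector [vector [B $ 2 $ 2 / det B, - B $ 1 $ 2 / det B],
    vector [- B $ 2 $ 1 / det B, B $ 1 $ 1 / det B]]" (is "_ = ?C")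
proof (rule matrix_inv_eqI)
  show "B ** ?C = mat 1"
    using assms
    by (simp add: vec_eq_iff forall_2 matrix_matrix_mult_def sum_2 mat_def vector_2 divide_simps)
      (simp add: det_2 algebra_simps)
  then show "?C ** B = mat 1"
    using matrix_left_right_inverse by blast
qed

text \<open>The numerator is \<open>det (A + B) - det A - det B\<close>, the symmetric bilinear form
  \<open>trace (A ** adj B)\<close> attached to the quadratic form \<open>det\<close>, where \<open>adj\<close> is the adjugate.\<close>

lemma trace_times_matrix_inv_2:
  fixes A B :: "'a::field^2^2"
  assumes "det B \<noteq> 0"
  shows "trace (A ** matrix_inv B) = (A $ 1 $ 1 * B $ 2 $ 2 - A $ 1 $ 2 * B $ 2 $ 1
    - A $ 2 $ 1 * B $ 1 $ 2 + A $ 2 $ 2 * B $ 1 $ 1) / det B"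
  unfolding matrix_inv_2[OF assms]
  by (simp add: trace_def sum_2 matrix_matrix_mult_def vector_2 add_divide_distrib diff_divide_distrib)

lemma det_blocks:
  fixes Z :: "real^2^4"
  shows "det (\<chi> i j. of_real (top_block Z $ i $ j) + \<i> * of_real (bottom_block Z $ i $ j))
    = cnj (K (column 1 Z \<and>\<^sub>E column 2 Z))"
  unfolding K_def wedge_coord
  by (simp add: det_2 top_block_def bottom_block_def vector_2 column_def complex_eq_iff algebra_simps)

theorem proposition5:
  fixes Z :: "real^2^4" and X Y :: "real^2^2" and z\<^sub>1 z\<^sub>2 :: "real^4"
    and U :: ext2 and Q :: "complex^2^2"
  assumes "lagrangian_frame Z"
    and "X = top_block Z" and "Y = bottom_block Z"
    and "z\<^sub>1 = column 1 Z" and "z\<^sub>2 = column 2 Z"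
    and "U = z\<^sub>1 \<and>\<^sub>E z\<^sub>2"
    and "Q = (\<chi> i j. of_real (X $ i $ j) - \<i> * of_real (Y $ i $ j))
           ** matrix_inv (\<chi> i j. of_real (X $ i $ j) + \<i> * of_real (Y $ i $ j))"
  shows "trace Q = 2 / cnj (K U) * of_real (ext2_coord U 1 + ext2_coord U 6)"
proof -
  define A :: "complex^2^2" where "A = (\<chi> i j. of_real (X $ i $ j) - \<i> * of_real (Y $ i $ j))"
  define B :: "complex^2^2" where "B = (\<chi> i j. of_real (X $ i $ j) + \<i> * of_real (Y $ i $ j))"
  have det: "det B = cnj (K U)"
    using det_blocks[of Z] by (simp add: B_def assms(2-6))
  moreover have "K U \<noteq> 0"
    using K_lagrangian_nonzero[OF assms(1)] by (simp add: assms(4-6))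
  ultimately have "trace Q = (A $ 1 $ 1 * B $ 2 $ 2 - A $ 1 $ 2 * B $ 2 $ 1
      - A $ 2 $ 1 * B $ 1 $ 2 + A $ 2 $ 2 * B $ 1 $ 1) / cnj (K U)"
    using trace_times_matrix_inv_2[of B A] by (simp add: assms(7) A_def B_def)
  also have "A $ 1 $ 1 * B $ 2 $ 2 - A $ 1 $ 2 * B $ 2 $ 1
      - A $ 2 $ 1 * B $ 1 $ 2 + A $ 2 $ 2 * B $ 1 $ 1
      = 2 * of_real (ext2_coord U 1 + ext2_coord U 6)"
    unfolding assms(6) wedge_coord
    by (simp add: A_def B_def assms(2-5) top_block_def bottom_block_def vector_2 column_def
        complex_eq_iff algebra_simps)
  finally show ?thesis
    by simp
qed

end
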